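(* Let $n\ge 2$ and let $D=(V(D),E(D),w)$ be a vertex-weighted oriented star graph with vertex set $V(D)=\{x_1,\ldots,x_n\}$ such that $w(x)\geq 2$ for every vertex $x$, and whose edge set $E(D)$ is one of the following three sets: $\{x_1x_2,x_1x_3,\ldots,x_1x_n\}$, $\{x_2x_1,x_3x_1,\ldots,x_nx_1\}$, or $\{x_1x_2,x_2x_3,x_2x_4,\ldots,x_2x_n\}$. Then $\operatorname{depth}(I(D))=2$.
   Context: A vertex-weighted oriented graph is a triple $D=(V(D),E(D),w)$, where $V(D)=\{x_1,\dots,x_n\}$ is a finite vertex set, $E(D)$ is a set of ordered pairs of distinct vertices such that each pair of vertices is joined by at most one edge, in only one direction, and $w:V(D)\to\{1,2,\ldots\}$ is a weight function. An edge written $uv$ is directed from its starting point $u$ to its ending point $v$. Put $w_j=w(x_j)$. Let $k$ be a field and $S=k[x_1,\ldots,x_n]$ with the standard grading. The edge ideal of $D$ is the ideal $I(D)=(x_ix_j^{w_j}\mid x_ix_j\in E(D))\subset S$, where $x_ix_j\in E(D)$ is directed from $x_i$ to $x_j$. Here $\operatorname{depth}(I(D))$ is the depth of the ideal $I(D)$ regarded as a graded $S$-module, with respect to the maximal ideal $(x_1,\ldots,x_n)$. *)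

theory Defs
  imports
    "HOL-Library.Poly_Mapping"
    "HOL-Library.Extended_Nat"
    "Graph_Theory.Pair_Digraph"
begin

section \<open>Vertex-weighted oriented graphs\<close>

locale vertex_weighted_oriented_graph = pair_digraph D
  for D :: "'v pair_pre_digraph" +
  fixes w :: "'v \<Rightarrow> nat"
  assumes oriented: "(u, v) \<in> parcs D \<Longrightarrow> (v, u) \<notin> parcs D"
    and weight_pos: "v \<in> pverts D \<Longrightarrow> 1 \<le> w v"

text \<open>A star is recognised on the underlying undirected graph: the edges join one vertex,
  the centre, to each of the others. Their directions are arbitrary.\<close>

locale vertex_weighted_oriented_star = vertex_weighted_oriented_graph D w
  for D :: "'v pair_pre_digraph" and w :: "'v \<Rightarrow> nat" +
  assumes star: "\<exists>c\<in>pverts D. (\<lambda>(u, v). {u, v}) ` parcs D = {{c, v} | v. v \<in> pverts D - {c}}"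


section \<open>Regular sequences and depth\<close>

text \<open>Throughout, \<open>scale\<close> is the scalar multiplication of a \<^locale>\<open>module\<close> and \<open>M\<close> a submodule of it.
  The following is the submodule \<open>I M\<close>, where \<open>I\<close> is the ideal generated by the set \<open>A\<close>.\<close>

definition submodule_mult ::
    "('a::comm_ring_1 \<Rightarrow> 'b::ab_group_add \<Rightarrow> 'b) \<Rightarrow> 'a set \<Rightarrow> 'b set \<Rightarrow> 'b set" where
  "submodule_mult scale A M = module.span scale {scale a m | a m. a \<in> A \<and> m \<in> M}"

text \<open>A list \<open>f\<^sub>1, \<dots>, f\<^sub>r\<close> is \<open>M\<close>-regular if each \<open>f\<^sub>i\<close> is a nonzerodivisor on
  \<open>M / (f\<^sub>1, \<dots>, f\<^sub>i\<^sub>-\<^sub>1) M\<close> and \<open>M / (f\<^sub>1, \<dots>, f\<^sub>r) M\<close> is nonzero. The quotients are not formed: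
  their zero elements are the elements of \<open>M\<close> lying in the submodule factored out.\<close>

definition regular_sequence ::
    "('a::comm_ring_1 \<Rightarrow> 'b::ab_group_add \<Rightarrow> 'b) \<Rightarrow> 'b set \<Rightarrow> 'a list \<Rightarrow> bool" where
  "regular_sequence scale M fs \<longleftrightarrow>
     (\<forall>i<length fs. \<forall>m\<in>M.
        scale (fs ! i) m \<in> submodule_mult scale (set (take i fs)) M \<longrightarrow>
        m \<in> submodule_mult scale (set (take i fs)) M) \<and>
     submodule_mult scale (set fs) M \<noteq> M"

text \<open>The depth of \<open>M\<close> with respect to the ideal \<open>I\<close>.\<close>

definition depth ::
    "('a::comm_ring_1 \<Rightarrow> 'b::ab_group_add \<Rightarrow> 'b) \<Rightarrow> 'a set \<Rightarrow> 'b set \<Rightarrow> enat" where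
  "depth scale I M =
     (if submodule_mult scale I M = M then \<infinity>
      else Sup {enat (length fs) | fs. set fs \<subseteq> I \<and> regular_sequence scale M fs})"

text \<open>Ideals of a commutative ring are its submodules. This is deliberately not turned into a
  global interpretation, which would declare \<open>a * (b * c) = (a * b) * c\<close> as a simp rule.\<close>

lemma module_times: "module ((*) :: 'a::comm_ring_1 \<Rightarrow> 'a \<Rightarrow> 'a)"
  by unfold_locales (simp_all add: algebra_simps)

abbreviation ideal_generated :: "'a::comm_ring_1 set \<Rightarrow> 'a set" where
  "ideal_generated \<equiv> module.span (*)"


section \<open>Edge ideals\<close>

text \<open>The ring of polynomials over \<open>'k\<close> with one variable for each element of \<open>'v\<close>: a polynomial
  maps exponent vectors to coefficients.\<close>

type_synonym ('v, 'k) mvpoly = "('v \<Rightarrow>\<^sub>0 nat) \<Rightarrow>\<^sub>0 'k"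

definition var :: "'v \<Rightarrow> ('v, 'k::field) mvpoly" where
  "var v = Poly_Mapping.single (Poly_Mapping.single v 1) 1"

definition irrelevant_ideal :: "('v, 'k::field) mvpoly set" where
  "irrelevant_ideal = ideal_generated (range var)"

definition edge_ideal :: "'v pair_pre_digraph \<Rightarrow> ('v \<Rightarrow> nat) \<Rightarrow> ('v, 'k::field) mvpoly set" where
  "edge_ideal D w = ideal_generated {var u * var v ^ w v | u v. (u, v) \<in> parcs D}"

end

theory Submission
  imports Defs
begin

text \<open>For each of the three orientations, \<open>I = I(D)\<close> is a monomial times an ideal generated by
  \<open>n - 1\<close> pairwise coprime monomials, a complete intersection whose quotient has depth \<open>1\<close>. As a
  module \<open>I\<close> is that complete intersection, so its depth is \<open>2\<close>. Both bounds are proved here for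
  regular sequences on a monomial ideal \<open>I\<close> by solving the Koszul relations explicitly.

  Lower bound: two variables \<open>z, y\<close> form a regular sequence on \<open>I\<close> as soon as every polynomial that
  both of them multiply into \<open>I\<close> lies in \<open>I\<close> (\<open>regular_sequence_two_variables\<close>).

  Upper bound (\<open>no_regular_sequence_of_length_three\<close>): the ideal \<open>P\<close> generated by all variables
  except one, \<open>z\<close>, is an associated prime of \<open>S / I\<close>, and \<open>S / P = k[z]\<close> has dimension \<open>1\<close>. Let \<open>s\<close>
  be a monomial outside \<open>I\<close> with \<open>P s \<subseteq> I\<close>, and put \<open>T = (I : P)\<close>. Suppose that \<open>f, g, h\<close> is a regular
  sequence on \<open>I\<close>. Modulo \<open>P\<close> these are polynomials in \<open>z\<close> without constant term; let \<open>z\<^sup>a\<close> be the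
  largest power dividing all three, with quotients \<open>f\<^sub>1, g\<^sub>1, h\<^sub>1\<close>. The vector \<open>(f\<^sub>1 s, g\<^sub>1 s, h\<^sub>1 s)\<close> is
  then a Koszul cycle over \<open>S / I\<close>, and \<open>regular_triple_lift\<close> says that it is \<open>t (f, g, h)\<close> modulo \<open>I\<close>
  for some \<open>t\<close>: the first Koszul homology of \<open>I\<close> vanishes by regularity, and the second one of \<open>S\<close>
  because \<open>f\<close> and \<open>g\<close> are coprime, which follows from \<open>monomial_ideal_multiplier\<close>. Since \<open>f\<close> and \<open>g\<close>
  multiply \<open>P t\<close> into \<open>I\<close>, even \<open>P t \<subseteq> I\<close> (\<open>regular_pair_colon\<close>), that is, \<open>t \<in> T\<close>. One of
  \<open>f\<^sub>1, g\<^sub>1, h\<^sub>1\<close>, say \<open>f\<^sub>1\<close>, has a constant term \<open>c \<noteq> 0\<close>, and \<open>f\<^sub>1 s = f t = f\<^sub>1 z\<^sup>a t\<close> modulo \<open>I\<close> gives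
  \<open>c s \<in> I + z T\<close>. The monomial \<open>s\<close> is chosen such that \<open>s / z \<notin> T\<close>, and then the coefficient at \<open>s\<close>
  yields \<open>c = 0\<close>.\<close>

section \<open>Short regular sequences on an ideal\<close>

abbreviation ideal :: "'a::comm_ring_1 set \<Rightarrow> bool" where
  "ideal \<equiv> module.subspace (*)"

lemmas ideal_simps =
  module.subspace_0[OF module_times] module.subspace_add[OF module_times]
  module.subspace_diff[OF module_times] module.subspace_neg[OF module_times]
  module.subspace_scale[OF module_times]

lemma ideal_mult_right: "ideal I \<Longrightarrow> a \<in> I \<Longrightarrow> a * b \<in> I"
  by (metis module.subspace_scale[OF module_times] mult.commute)

lemma submodule_mult_empty: "submodule_mult (*) {} I = {0::'a::comm_ring_1}"
  by (simp add: submodule_mult_def module.span_empty[OF module_times])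

lemma submodule_mult_singleton:
  fixes I :: "'a::comm_ring_1 set"
  assumes "ideal I"
  shows "submodule_mult (*) {f} I = {f * i | i. i \<in> I}"
  unfolding submodule_mult_def
proof (rule module.span_unique[OF module_times])
  show "ideal {f * i | i. i \<in> I}"
    unfolding module.subspace_def[OF module_times]
  proof (intro conjI ballI allI)
    show "0 \<in> {f * i | i. i \<in> I}"
      using ideal_simps(1)[OF assms] by force
    fix a b assume a: "a \<in> {f * i | i. i \<in> I}"
    then obtain i where i: "i \<in> I" "a = f * i" by blast
    show "c * a \<in> {f * i | i. i \<in> I}" for c
      using i ideal_simps(5)[OF assms i(1), of c] by (force simp: algebra_simps)
    assume "b \<in> {f * i | i. i \<in> I}"
    then obtain j where "j \<in> I" "b = f * j" by blast
    then show "a + b \<in> {f * i | i. i \<in> I}"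
      using i ideal_simps(2)[OF assms, of i j] by (force simp: algebra_simps)
  qed
next
  show "\<And>T. {a * m |a m. a \<in> {f} \<and> m \<in> I} \<subseteq> T \<Longrightarrow> ideal T \<Longrightarrow> {f * i |i. i \<in> I} \<subseteq> T"
    by blast
qed blast

lemma submodule_mult_pair:
  fixes I :: "'a::comm_ring_1 set"
  assumes "ideal I"
  shows "submodule_mult (*) {f, g} I = {f * i + g * j | i j. i \<in> I \<and> j \<in> I}"
proof -
  have "{a * m |a m. a \<in> {f, g} \<and> m \<in> I} =
      {a * m |a m. a \<in> {f} \<and> m \<in> I} \<union> {a * m |a m. a \<in> {g} \<and> m \<in> I}"
    by blast
  then have "submodule_mult (*) {f, g} I =
      {x + y | x y. x \<in> submodule_mult (*) {f} I \<and> y \<in> submodule_mult (*) {g} I}"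
    unfolding submodule_mult_def by (simp only: module.span_Un[OF module_times])
  also have "\<dots> = {f * i + g * j | i j. i \<in> I \<and> j \<in> I}"
    unfolding submodule_mult_singleton[OF assms] by blast
  finally show ?thesis .
qed

lemma submodule_mult_mono:
  fixes A B :: "'a::comm_ring_1 set"
  assumes "A \<subseteq> B"
  shows "submodule_mult (*) A M \<subseteq> submodule_mult (*) B M"
  unfolding submodule_mult_def using assms
  by (intro module.span_mono[OF module_times]) blast

lemma submodule_mult_subset:
  assumes "ideal I"
  shows "submodule_mult (*) A I \<subseteq> I"
  unfolding submodule_mult_def using assms
  by (intro module.span_minimal[OF module_times]) (auto intro: ideal_simps(5))

lemma regular_sequence_of_length_twoI:
  assumes "ideal I"
    and "\<And>m. m \<in> I \<Longrightarrow> f * m = 0 \<Longrightarrow> m = 0"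
    and "\<And>m i. m \<in> I \<Longrightarrow> i \<in> I \<Longrightarrow> g * m = f * i \<Longrightarrow> \<exists>j\<in>I. m = f * j"
    and "submodule_mult (*) {f, g} I \<noteq> I"
  shows "regular_sequence (*) I [f, g]"
  unfolding regular_sequence_def
proof (intro conjI allI impI ballI)
  fix i m
  assume i: "i < length [f, g]" and m: "m \<in> I"
    and *: "[f, g] ! i * m \<in> submodule_mult (*) (set (take i [f, g])) I"
  consider "i = 0" | "i = Suc 0" using i by fastforce
  then show "m \<in> submodule_mult (*) (set (take i [f, g])) I"
  proof cases
    case 1
    then show ?thesis using * assms(2)[OF m] by (simp add: submodule_mult_empty)
  next
    case 2
    then show ?thesis using * assms(3)[OF m]
      by (auto simp: submodule_mult_singleton[OF assms(1)])
  qed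
qed (use assms(4) in simp)

lemma regular_sequence_of_length_threeD:
  assumes "ideal I" "regular_sequence (*) I (f # g # h # fs)"
  shows "\<And>m. m \<in> I \<Longrightarrow> f * m = 0 \<Longrightarrow> m = 0"
    and "\<And>m i. m \<in> I \<Longrightarrow> i \<in> I \<Longrightarrow> g * m = f * i \<Longrightarrow> \<exists>j\<in>I. m = f * j"
    and "\<And>m i j. m \<in> I \<Longrightarrow> i \<in> I \<Longrightarrow> j \<in> I \<Longrightarrow> h * m = f * i + g * j \<Longrightarrow>
           \<exists>i'\<in>I. \<exists>j'\<in>I. m = f * i' + g * j'"
proof -
  have reg: "(f # g # h # fs) ! k * m \<in> submodule_mult (*) (set (take k (f # g # h # fs))) I \<Longrightarrow>
      m \<in> submodule_mult (*) (set (take k (f # g # h # fs))) I"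
    if "m \<in> I" "k < 3" for k m
    using assms(2) that unfolding regular_sequence_def by simp
  show "m = 0" if "m \<in> I" "f * m = 0" for m
    using reg[of m 0] that by (simp add: submodule_mult_empty)
  show "\<exists>j\<in>I. m = f * j" if "m \<in> I" "i \<in> I" "g * m = f * i" for m i
    using reg[of m 1] that by (auto simp: submodule_mult_singleton[OF assms(1)])
  show "\<exists>i'\<in>I. \<exists>j'\<in>I. m = f * i' + g * j'"
    if "m \<in> I" "i \<in> I" "j \<in> I" "h * m = f * i + g * j" for m i j
    using reg[of m 2] that by (auto simp: submodule_mult_pair[OF assms(1)] numeral_2_eq_2)
qed

text \<open>The Koszul relation \<open>g (f u) = f (g u)\<close> has entries in \<open>I\<close>, where it must be trivial. In
  homological terms: if \<open>I\<close> has depth at least two then \<open>R / I\<close> has depth at least one.\<close>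

lemma regular_pair_colon:
  assumes "ideal I"
    and f_cancel: "\<And>a. f * a = 0 \<Longrightarrow> a = (0::'a::comm_ring_1)"
    and g_reg: "\<And>m i. m \<in> I \<Longrightarrow> i \<in> I \<Longrightarrow> g * m = f * i \<Longrightarrow> \<exists>j\<in>I. m = f * j"
    and "f * u \<in> I" "g * u \<in> I"
  shows "u \<in> I"
proof -
  have "g * (f * u) = f * (g * u)" by (simp add: algebra_simps)
  then obtain j where j: "j \<in> I" "f * u = f * j"
    using g_reg assms(4,5) by blast
  then have "f * (u - j) = 0" by (simp add: algebra_simps)
  then show ?thesis using f_cancel j(1) by force
qed

text \<open>The hypotheses on \<open>f\<^sub>1, g\<^sub>1, h\<^sub>1\<close> make all two-by-two minors of the rows \<open>(f, g, h)\<close> and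
  \<open>(f\<^sub>1 s, g\<^sub>1 s, h\<^sub>1 s)\<close> lie in \<open>I\<close>. The minors satisfy a Koszul relation with coefficients
  \<open>f, g, h\<close>, which regularity on \<open>I\<close> solves inside \<open>I\<close>. So the second row can be corrected by elements
  of \<open>I\<close> until its minors vanish, that is, until it is proportional to the first one.
  The cancellation and coprimality hypotheses stand in for unique factorisation.\<close>

lemma regular_triple_lift:
  fixes f g h :: "'a::comm_ring_1"
  assumes I: "ideal I"
    and f_cancel: "\<And>a. f * a = 0 \<Longrightarrow> a = 0"
    and g_reg: "\<And>m i. m \<in> I \<Longrightarrow> i \<in> I \<Longrightarrow> g * m = f * i \<Longrightarrow> \<exists>j\<in>I. m = f * j"
    and h_reg: "\<And>m i j. m \<in> I \<Longrightarrow> i \<in> I \<Longrightarrow> j \<in> I \<Longrightarrow> h * m = f * i + g * j \<Longrightarrow>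
           \<exists>i'\<in>I. \<exists>j'\<in>I. m = f * i' + g * j'"
    and coprime: "\<And>u v. g * u = f * v \<Longrightarrow> \<exists>t. u = f * t"
    and f1: "(f - f1 * d) * s \<in> I" and g1: "(g - g1 * d) * s \<in> I" and h1: "(h - h1 * d) * s \<in> I"
  shows "\<exists>t. f * t - f1 * s \<in> I \<and> g * t - g1 * s \<in> I \<and> h * t - h1 * s \<in> I"
proof -
  define A where "A = f1 * (g * s) - g1 * (f * s)"
  define B where "B = f1 * (h * s) - h1 * (f * s)"
  define C where "C = g1 * (h * s) - h1 * (g * s)"
  \<comment> \<open>Modulo \<open>(I : s)\<close> one has \<open>p = p\<^sub>1 d\<close> and \<open>q = q\<^sub>1 d\<close>, so \<open>p\<^sub>1 q - q\<^sub>1 p\<close> vanishes there.\<close>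
  have minor: "p1 * (q * s) - q1 * (p * s) \<in> I"
    if "(p - p1 * d) * s \<in> I" "(q - q1 * d) * s \<in> I" for p p1 q q1
  proof -
    have "p1 * ((q - q1 * d) * s) - q1 * ((p - p1 * d) * s) \<in> I"
      by (rule ideal_simps(3)[OF I ideal_simps(5)[OF I that(2)] ideal_simps(5)[OF I that(1)]])
    then show ?thesis by (simp add: algebra_simps)
  qed
  have ABC: "A \<in> I" "B \<in> I" "C \<in> I"
    unfolding A_def B_def C_def using minor f1 g1 h1 by blast+
  have rel: "h * A = f * (- C) + g * B"
    by (simp add: A_def B_def C_def algebra_simps)
  obtain i j where ij: "i \<in> I" "j \<in> I" "A = f * i + g * j"
    using h_reg[OF ABC(1) _ ABC(2) rel] ideal_simps(4)[OF I ABC(3)] by blast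
  have "g * (f1 * s - j) = f * (g1 * s + i)"
    using ij(3) by (simp add: A_def algebra_simps)
  then obtain t where t: "f1 * s - j = f * t" using coprime by blast
  have "f * (g1 * s + i - g * t) = 0"
    using \<open>g * (f1 * s - j) = f * (g1 * s + i)\<close> unfolding t by (simp add: algebra_simps)
  then have gt: "g * t = g1 * s + i" using f_cancel by fastforce
  have "g * (B - h * j) = f * (C + h * i)"
    using rel ij(3) by (simp add: algebra_simps)
  moreover have "B - h * j \<in> I" "C + h * i \<in> I"
    using ABC ij by (auto intro!: ideal_simps(2,3,5)[OF I])
  ultimately obtain l where l: "l \<in> I" "B - h * j = f * l"
    using g_reg by blast
  have "f * (h * t - h1 * s - l) = h * (f * t) - h1 * (f * s) - f * l"
    by (simp add: algebra_simps)
  also have "\<dots> = 0"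
    unfolding t[symmetric] l(2)[symmetric] by (simp add: B_def algebra_simps)
  finally have ht: "h * t - h1 * s = l" using f_cancel by force
  have ft: "f * t - f1 * s = - j" using t by (simp add: algebra_simps)
  have gt': "g * t - g1 * s = i" using gt by (simp add: algebra_simps)
  show ?thesis
    using ft gt' ht ideal_simps(4)[OF I ij(2)] ij(1) l(1) by metis
qed

section \<open>Monomial ideals\<close>

abbreviation (input) "lookup \<equiv> Poly_Mapping.lookup"
abbreviation (input) "keys \<equiv> Poly_Mapping.keys"

definition monomial :: "('v \<Rightarrow>\<^sub>0 nat) \<Rightarrow> ('v, 'k::field) mvpoly" where
  "monomial \<tau> = Poly_Mapping.single \<tau> 1"

definition monomial_ideal :: "('v \<Rightarrow>\<^sub>0 nat) set \<Rightarrow> ('v, 'k::field) mvpoly set" where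
  "monomial_ideal G = ideal_generated (monomial ` G)"

text \<open>The exponents of the monomials in the monomial ideal given by \<open>G\<close>: divisibility of monomials is
  the componentwise order.\<close>

definition multiples :: "('v \<Rightarrow>\<^sub>0 nat) set \<Rightarrow> ('v \<Rightarrow>\<^sub>0 nat) set" where
  "multiples G = {\<tau>. \<exists>\<gamma>\<in>G. \<forall>v. lookup \<gamma> v \<le> lookup \<tau> v}"

abbreviation unit_exponent :: "'v \<Rightarrow> 'v \<Rightarrow>\<^sub>0 nat" where
  "unit_exponent v \<equiv> Poly_Mapping.single v 1"

lemma exponent_le_imp_add:
  assumes "\<forall>v. lookup \<gamma> v \<le> lookup \<tau> v"
  shows "\<exists>\<rho>. \<tau> = \<gamma> + (\<rho> :: 'v \<Rightarrow>\<^sub>0 nat)"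
proof
  show "\<tau> = \<gamma> + (\<tau> - \<gamma>)"
    using assms by (intro poly_mapping_eqI) (simp add: lookup_add lookup_minus)
qed

lemma unit_exponent_le_iff:
  "(\<forall>u. lookup (unit_exponent v) u \<le> lookup \<tau> u) \<longleftrightarrow> 1 \<le> lookup \<tau> v"
  by (auto simp: lookup_single when_def)

lemma multiples_add: "\<tau> \<in> multiples G \<Longrightarrow> \<rho> + \<tau> \<in> multiples G"
  by (fastforce simp: multiples_def lookup_add intro: trans_le_add2)

lemma monomial_mult: "monomial \<rho> * monomial \<tau> = monomial (\<rho> + \<tau>)"
  by (simp add: monomial_def mult_single)

lemma lookup_monomial_mult:
  fixes f :: "('v, 'k::field) mvpoly"
  shows "lookup (monomial \<gamma> * f) (\<gamma> + \<tau>) = lookup f \<tau>"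
proof -
  have "lookup (monomial \<gamma> * f) (\<gamma> + \<tau>) =
      (\<Sum>l. (1 when \<gamma> = l) * (\<Sum>q. lookup f q when \<gamma> + \<tau> = l + q))"
    by (simp add: monomial_def lookup_mult lookup_single)
  also have "\<dots> = lookup f \<tau>"
    by (simp add: when_mult)
  finally show ?thesis .
qed

lemma monomial_cancel:
  fixes f g :: "('v, 'k::field) mvpoly"
  assumes "monomial \<gamma> * f = monomial \<gamma> * g"
  shows "f = g"
  using assms by (metis lookup_monomial_mult poly_mapping_eqI)

lemma keys_monomial_mult:
  fixes f :: "('v, 'k::field) mvpoly"
  shows "keys (monomial \<gamma> * f) = (+) \<gamma> ` keys f"
proof
  show "keys (monomial \<gamma> * f) \<subseteq> (+) \<gamma> ` keys f"
    using keys_mult[of "monomial \<gamma>" f] by (auto simp: monomial_def)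
  show "(+) \<gamma> ` keys f \<subseteq> keys (monomial \<gamma> * f)"
    by (auto simp: in_keys_iff lookup_monomial_mult)
qed

lemma ideal_monomial_ideal: "ideal (monomial_ideal G)"
  by (simp add: monomial_ideal_def module.subspace_span[OF module_times])

lemma poly_mapping_sum_single:
  "(\<Sum>\<tau>\<in>keys f. Poly_Mapping.single \<tau> (lookup f \<tau>)) = f"
  by (rule poly_mapping_eqI)
     (auto simp: lookup_sum lookup_single when_def in_keys_iff
        sum.delta[OF finite_keys, simplified])

lemma mem_monomial_ideal_iff:
  fixes f :: "('v, 'k::field) mvpoly"
  shows "f \<in> monomial_ideal G \<longleftrightarrow> keys f \<subseteq> multiples G"
proof
  have "ideal {f :: ('v, 'k) mvpoly. keys f \<subseteq> multiples G}"
    unfolding module.subspace_def[OF module_times]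
  proof (intro conjI ballI allI; clarify)
    fix f g :: "('v, 'k) mvpoly" and \<tau>
    assume f: "keys f \<subseteq> multiples G"
    show "\<tau> \<in> keys (c * f) \<Longrightarrow> \<tau> \<in> multiples G" for c
      using keys_mult[of c f] f multiples_add by fastforce
    assume "keys g \<subseteq> multiples G"
    then show "\<tau> \<in> keys (f + g) \<Longrightarrow> \<tau> \<in> multiples G"
      using keys_add[of f g] f by blast
  qed simp
  then have "monomial_ideal G \<subseteq> {f :: ('v, 'k) mvpoly. keys f \<subseteq> multiples G}"
    unfolding monomial_ideal_def
    by (intro module.span_minimal[OF module_times])
       (auto simp: monomial_def multiples_def)
  then show "f \<in> monomial_ideal G \<Longrightarrow> keys f \<subseteq> multiples G" by blast
next
  assume f: "keys f \<subseteq> multiples G"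
  have "Poly_Mapping.single \<tau> c \<in> monomial_ideal G" if \<tau>: "\<tau> \<in> multiples G" for \<tau> and c :: 'k
  proof -
    obtain \<gamma> \<rho> where \<gamma>: "\<gamma> \<in> G" "\<tau> = \<gamma> + \<rho>"
      using \<tau> exponent_le_imp_add unfolding multiples_def by blast
    have "Poly_Mapping.single \<tau> c = Poly_Mapping.single \<rho> c * monomial \<gamma>"
      by (simp add: monomial_def mult_single \<gamma>(2) add.commute)
    moreover have "monomial \<gamma> \<in> monomial_ideal G"
      using \<gamma>(1) by (simp add: monomial_ideal_def module.span_base[OF module_times])
    ultimately show ?thesis using ideal_simps(5)[OF ideal_monomial_ideal] by metis
  qed
  then have "(\<Sum>\<tau>\<in>keys f. Poly_Mapping.single \<tau> (lookup f \<tau>)) \<in> monomial_ideal G"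
    using f by (intro module.subspace_sum[OF module_times ideal_monomial_ideal]) blast
  then show "f \<in> monomial_ideal G" by (simp add: poly_mapping_sum_single)
qed

lemma monomial_mem_iff:
  "(monomial \<tau> :: ('v, 'k::field) mvpoly) \<in> monomial_ideal G \<longleftrightarrow> \<tau> \<in> multiples G"
  by (simp add: mem_monomial_ideal_iff monomial_def)

lemma lookup_eq_0_of_mem_monomial_ideal:
  "f \<in> monomial_ideal G \<Longrightarrow> \<tau> \<notin> multiples G \<Longrightarrow> lookup f \<tau> = 0"
  by (auto simp: mem_monomial_ideal_iff in_keys_iff)

lemma monomial_ideal_insert_iff:
  "f \<in> monomial_ideal (insert \<gamma> G) \<longleftrightarrow> (\<exists>c. f - c * monomial \<gamma> \<in> monomial_ideal G)"
  by (simp add: monomial_ideal_def module.span_breakdown_eq[OF module_times])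

lemma var_eq_monomial: "var v = monomial (unit_exponent v)"
  by (simp add: var_def monomial_def)

lemma irrelevant_ideal_eq: "irrelevant_ideal = monomial_ideal (range unit_exponent)"
  by (simp add: irrelevant_ideal_def monomial_ideal_def image_image var_eq_monomial[abs_def])

lemma mem_multiples_unit_exponents_iff:
  "\<tau> \<in> multiples (unit_exponent ` V) \<longleftrightarrow> (\<exists>v\<in>V. 1 \<le> lookup \<tau> v)"
  unfolding multiples_def by (simp only: mem_Collect_eq bex_simps unit_exponent_le_iff)

lemma mem_irrelevant_ideal_iff: "f \<in> irrelevant_ideal \<longleftrightarrow> lookup f 0 = 0"
proof -
  have "\<tau> \<in> multiples (range unit_exponent) \<longleftrightarrow> \<tau> \<noteq> 0" for \<tau> :: "'a \<Rightarrow>\<^sub>0 nat"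
    unfolding mem_multiples_unit_exponents_iff
    by (auto simp: poly_mapping_eq_iff fun_eq_iff Suc_le_eq)
  then show ?thesis
    unfolding irrelevant_ideal_eq mem_monomial_ideal_iff
    by (auto simp: in_keys_iff)
qed

lemma irrelevant_ideal_eq_insert:
  "irrelevant_ideal = monomial_ideal (insert (unit_exponent z) (unit_exponent ` (- {z})))"
  unfolding irrelevant_ideal_eq by (rule arg_cong[where f = monomial_ideal]) auto

text \<open>The products lie in the monomial ideal given by all \<open>\<gamma> + e\<^sub>v\<close>, which contains no monomial of
  the least degree that occurs in \<open>G\<close>.\<close>

lemma irrelevant_ideal_mult_monomial_ideal:
  fixes G :: "('v::finite \<Rightarrow>\<^sub>0 nat) set"
  assumes "G \<noteq> {}"
  shows "submodule_mult (*) irrelevant_ideal (monomial_ideal G :: ('v, 'k::field) mvpoly set)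
    \<noteq> monomial_ideal G"
proof
  assume eq: "submodule_mult (*) irrelevant_ideal (monomial_ideal G :: ('v, 'k) mvpoly set)
    = monomial_ideal G"
  define deg where "deg \<tau> = (\<Sum>v\<in>UNIV. lookup \<tau> v)" for \<tau> :: "'v \<Rightarrow>\<^sub>0 nat"
  obtain \<gamma> where \<gamma>: "\<gamma> \<in> G" "\<And>\<gamma>'. \<gamma>' \<in> G \<Longrightarrow> deg \<gamma> \<le> deg \<gamma>'"
    using ex_has_least_nat[of "\<lambda>\<gamma>. \<gamma> \<in> G" _ deg] assms by blast
  define H where "H = {\<gamma>' + unit_exponent v | \<gamma>' v. \<gamma>' \<in> G}"
  have "submodule_mult (*) irrelevant_ideal (monomial_ideal G :: ('v, 'k) mvpoly set)
      \<subseteq> monomial_ideal H"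
    unfolding submodule_mult_def
  proof (intro module.span_minimal[OF module_times _ ideal_monomial_ideal] subsetI; clarify)
    fix p i :: "('v, 'k) mvpoly"
    assume p: "p \<in> irrelevant_ideal" and i: "i \<in> monomial_ideal G"
    show "p * i \<in> monomial_ideal H"
      unfolding mem_monomial_ideal_iff
    proof
      fix \<tau> assume "\<tau> \<in> keys (p * i)"
      then obtain a b where ab: "\<tau> = a + b" "a \<in> keys p" "b \<in> keys i"
        using keys_mult[of p i] by blast
      obtain v where v: "1 \<le> lookup a v"
        using p ab(2) unfolding irrelevant_ideal_eq mem_monomial_ideal_iff
        by (metis mem_multiples_unit_exponents_iff subsetD)
      obtain \<gamma>' where \<gamma>': "\<gamma>' \<in> G" "\<forall>u. lookup \<gamma>' u \<le> lookup b u"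
        using i ab(3) unfolding mem_monomial_ideal_iff multiples_def by blast
      have "\<forall>u. lookup (\<gamma>' + unit_exponent v) u \<le> lookup \<tau> u"
        using v \<gamma>'(2) add_mono[OF v \<gamma>'(2)[rule_format, of v]] unfolding ab(1) lookup_add lookup_single
        by (auto simp: when_def intro: trans_le_add2)
      then show "\<tau> \<in> multiples H" using \<gamma>'(1) unfolding multiples_def H_def by blast
    qed
  qed
  moreover have "monomial \<gamma> \<in> (monomial_ideal G :: ('v, 'k) mvpoly set)"
    using \<gamma>(1) by (auto simp: monomial_mem_iff multiples_def)
  ultimately have "\<gamma> \<in> multiples H"
    unfolding eq using monomial_mem_iff by blast
  then obtain \<gamma>' v where \<gamma>': "\<gamma>' \<in> G" "\<forall>u. lookup (\<gamma>' + unit_exponent v) u \<le> lookup \<gamma> u"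
    unfolding multiples_def H_def by blast
  have "deg (\<gamma>' + unit_exponent v) \<le> deg \<gamma>"
    unfolding deg_def using \<gamma>'(2) by (intro sum_mono) blast
  moreover have "deg (\<gamma>' + unit_exponent v) = deg \<gamma>' + 1"
    by (simp add: deg_def lookup_add sum.distrib lookup_single when_def)
  ultimately show False using \<gamma>(2)[OF \<gamma>'(1)] by simp
qed

text \<open>A fraction \<open>u / f\<close> that multiplies a nonzero ideal into itself is integral over the ring, hence
  a polynomial by normality. For a monomial ideal this can be seen on exponents: multiplying
  \<open>\<alpha> \<in> G\<close> by \<open>u / f\<close> gives a polynomial \<open>j\<close>, and multiplying a generator \<open>\<beta>\<close> with the least
  exponent of \<open>v\<close> cannot lower that exponent, so \<open>u / f\<close> has no negative power of \<open>v\<close>. Hence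
  \<open>\<alpha>\<close> divides \<open>j\<close>.\<close>

lemma monomial_ideal_multiplier:
  fixes f u :: "('v, 'k::field) mvpoly"
  assumes "G \<noteq> {}"
    and f_cancel: "\<And>a. f * a = 0 \<Longrightarrow> a = 0"
    and mult: "\<And>i. i \<in> monomial_ideal G \<Longrightarrow> \<exists>j\<in>monomial_ideal G. u * i = f * j"
  shows "\<exists>t. u = f * t"
proof -
  have mem: "monomial \<gamma> \<in> (monomial_ideal G :: ('v, 'k) mvpoly set)" if "\<gamma> \<in> G" for \<gamma>
    using that by (auto simp: monomial_mem_iff multiples_def)
  obtain \<alpha> where \<alpha>: "\<alpha> \<in> G" using assms(1) by blast
  obtain j where j: "j \<in> monomial_ideal G" "u * monomial \<alpha> = f * j"
    using mult[OF mem[OF \<alpha>]] by blast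
  have "lookup \<alpha> v \<le> lookup \<kappa> v" if \<kappa>: "\<kappa> \<in> keys j" for \<kappa> v
  proof -
    obtain \<beta> where \<beta>: "\<beta> \<in> G" "\<And>\<gamma>. \<gamma> \<in> G \<Longrightarrow> lookup \<beta> v \<le> lookup \<gamma> v"
      using ex_has_least_nat[of "\<lambda>\<gamma>. \<gamma> \<in> G" \<alpha> "\<lambda>\<gamma>. lookup \<gamma> v"] \<alpha> by blast
    obtain j' where j': "j' \<in> monomial_ideal G" "u * monomial \<beta> = f * j'"
      using mult[OF mem[OF \<beta>(1)]] by blast
    have "f * (monomial \<beta> * j) = monomial \<beta> * (u * monomial \<alpha>)"
      unfolding j(2) by (simp add: algebra_simps)
    also have "\<dots> = monomial \<alpha> * (u * monomial \<beta>)"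
      by (simp add: algebra_simps)
    also have "\<dots> = f * (monomial \<alpha> * j')"
      unfolding j'(2) by (simp add: algebra_simps)
    finally have "f * (monomial \<beta> * j - monomial \<alpha> * j') = 0"
      by (simp add: algebra_simps)
    then have "monomial \<beta> * j = monomial \<alpha> * j'" using f_cancel by fastforce
    then have "\<beta> + \<kappa> \<in> (+) \<alpha> ` keys j'"
      using \<kappa> keys_monomial_mult by (metis imageI)
    then obtain \<kappa>' where \<kappa>': "\<kappa>' \<in> keys j'" "\<beta> + \<kappa> = \<alpha> + \<kappa>'" by blast
    have "\<kappa>' \<in> multiples G" using \<kappa>'(1) j'(1) by (auto simp: mem_monomial_ideal_iff)
    then have "lookup \<beta> v \<le> lookup \<kappa>' v"
      using \<beta>(2) unfolding multiples_def by (blast intro: le_trans)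
    moreover have "lookup \<beta> v + lookup \<kappa> v = lookup \<alpha> v + lookup \<kappa>' v"
      using \<kappa>'(2) by (metis lookup_add)
    ultimately show ?thesis by simp
  qed
  then have "j \<in> monomial_ideal {\<alpha>}"
    by (auto simp: mem_monomial_ideal_iff multiples_def)
  then obtain t where t: "j = t * monomial \<alpha>"
    by (auto simp: monomial_ideal_def module.span_singleton[OF module_times])
  have "monomial \<alpha> * u = monomial \<alpha> * (f * t)"
    using j(2) unfolding t by (simp add: algebra_simps)
  then show ?thesis using monomial_cancel by blast
qed

section \<open>Bounds for the depth of a monomial ideal\<close>

text \<open>The hypotheses say that \<open>s = z \<rho>\<close> is a monomial outside \<open>I\<close> that all variables but \<open>z\<close>
  multiply into \<open>I\<close>, and that \<open>\<rho> = s / z\<close> does not have the latter property, as \<open>y\<close> shows. So \<open>s\<close> is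
  not a multiple of \<open>z\<close> within \<open>(I : P) / I\<close>, where \<open>P\<close> is generated by the variables other than
  \<open>z\<close>. A regular sequence of length three on \<open>I\<close> would make it one.\<close>

lemma no_regular_sequence_of_length_three:
  fixes f g h :: "('v, 'k::field) mvpoly" and \<rho> :: "'v \<Rightarrow>\<^sub>0 nat"
  assumes reg: "regular_sequence (*) (monomial_ideal G) (f # g # h # fs)"
    and irr: "f \<in> irrelevant_ideal" "g \<in> irrelevant_ideal" "h \<in> irrelevant_ideal"
    and notin: "unit_exponent z + \<rho> \<notin> multiples G"
    and socle: "\<And>v. v \<noteq> z \<Longrightarrow> unit_exponent v + (unit_exponent z + \<rho>) \<in> multiples G"
    and y: "y \<noteq> z" "unit_exponent y + \<rho> \<notin> multiples G"
  shows False
proof -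
  define I where "I = (monomial_ideal G :: ('v, 'k) mvpoly set)"
  define P where "P = (monomial_ideal (unit_exponent ` (- {z})) :: ('v, 'k) mvpoly set)"
  define Q where "Q a = (monomial_ideal (insert (Poly_Mapping.single z a) (unit_exponent ` (- {z})))
    :: ('v, 'k) mvpoly set)" for a
  define s where "s = (monomial (unit_exponent z + \<rho>) :: ('v, 'k) mvpoly)"
  define x where "x a = (monomial (Poly_Mapping.single z a) :: ('v, 'k) mvpoly)" for a
  have I: "ideal I" and P: "ideal P"
    by (simp_all add: I_def P_def ideal_monomial_ideal)
  have G: "G \<noteq> {}" using socle[OF y(1)] by (auto simp: multiples_def)
  then obtain \<alpha> where \<alpha>: "\<alpha> \<in> G" by blast
  have mon\<alpha>: "monomial \<alpha> \<in> I"
    using \<alpha> by (auto simp: I_def monomial_mem_iff multiples_def)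
  note reg' = regular_sequence_of_length_threeD[OF ideal_monomial_ideal reg, folded I_def]
  have f_cancel: "a = 0" if "f * a = 0" for a
  proof -
    have "f * (monomial \<alpha> * a) = monomial \<alpha> * (f * a)" by (simp add: algebra_simps)
    then have "monomial \<alpha> * a = monomial \<alpha> * 0"
      using reg'(1) ideal_mult_right[OF I mon\<alpha>] that by simp
    then show ?thesis by (rule monomial_cancel)
  qed
  have coprime: "\<exists>t. u = f * t" if "g * u = f * v" for u v
  proof (rule monomial_ideal_multiplier[where f = f, OF G f_cancel])
    fix i :: "('v, 'k) mvpoly" assume "i \<in> monomial_ideal G"
    then have i: "i \<in> I" by (simp add: I_def)
    have "g * (u * i) = (g * u) * i" by (simp add: algebra_simps)
    also have "\<dots> = f * (v * i)" unfolding that by (simp add: algebra_simps)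
    finally have "g * (u * i) = f * (v * i)" .
    then show "\<exists>j\<in>monomial_ideal G. u * i = f * j"
      using reg'(2) ideal_simps(5)[OF I i] unfolding I_def by blast
  qed
  have colon: "u \<in> I" if "f * u \<in> I" "g * u \<in> I" for u
    by (rule regular_pair_colon[where f = f and g = g, OF I]) (fact f_cancel reg'(2) that)+
  have P_mult: "p * t \<in> I" if "p \<in> P" "\<And>v. v \<noteq> z \<Longrightarrow> var v * t \<in> I" for p t
  proof -
    have "ideal {p. p * t \<in> I}"
      unfolding module.subspace_def[OF module_times]
      using I ideal_simps(1,2,5)[OF I] by (auto simp: distrib_right mult.assoc)
    then have "P \<subseteq> {p. p * t \<in> I}"
      unfolding P_def monomial_ideal_def using that(2)
      by (intro module.span_minimal[OF module_times]) (auto simp: var_eq_monomial)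
    then show ?thesis using that(1) by blast
  qed
  have s_notin: "s \<notin> I" using notin by (simp add: s_def I_def monomial_mem_iff)
  have s_socle: "var v * s \<in> I" if "v \<noteq> z" for v
    using socle[OF that] by (simp add: s_def I_def var_eq_monomial monomial_mult monomial_mem_iff)
  have Ps: "p * s \<in> I" if "p \<in> P" for p
    using P_mult[OF that] s_socle by blast
  have Q_iff: "p \<in> Q a \<longleftrightarrow> (\<exists>c. p - c * x a \<in> P)" for p a
    by (simp add: Q_def P_def x_def monomial_ideal_insert_iff)
  have Q_1: "irrelevant_ideal = Q 1"
    unfolding Q_def by (rule irrelevant_ideal_eq_insert)
  \<comment> \<open>An exponent vector in \<open>p\<close> free of the other variables is excluded from \<open>Q a\<close> for \<open>a\<close> large.\<close>
  have Q_all: "p \<in> P" if "\<And>a. p \<in> Q a" for p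
    unfolding P_def mem_monomial_ideal_iff
  proof
    fix \<tau> assume "\<tau> \<in> keys p"
    then have "\<tau> \<in> multiples (insert (Poly_Mapping.single z (Suc (lookup \<tau> z)))
        (unit_exponent ` (- {z})))"
      using that[of "Suc (lookup \<tau> z)"] unfolding Q_def mem_monomial_ideal_iff by blast
    moreover have "\<not> (\<forall>v. lookup (Poly_Mapping.single z (Suc (lookup \<tau> z))) v \<le> lookup \<tau> v)"
      by (metis lookup_single_eq not_less_eq_eq order_refl)
    ultimately show "\<tau> \<in> multiples (unit_exponent ` (- {z}))"
      unfolding multiples_def by blast
  qed
  \<comment> \<open>\<open>A a\<close>: modulo \<open>P\<close>, all of \<open>f, g, h\<close> are divisible by \<open>z\<^sup>a\<close>. If this held for all \<open>a\<close>, then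
    \<open>f\<close> and \<open>g\<close> would multiply \<open>s\<close> into \<open>I\<close>.\<close>
  define A where "A a \<longleftrightarrow> f \<in> Q a \<and> g \<in> Q a \<and> h \<in> Q a" for a
  have "\<exists>b. \<not> A b"
  proof (rule ccontr)
    assume "\<not> (\<exists>b. \<not> A b)"
    then have "f \<in> P" "g \<in> P" using Q_all unfolding A_def by blast+
    then have "s \<in> I" using colon Ps by blast
    then show False using s_notin by blast
  qed
  moreover have A1: "A 1" using irr by (simp add: A_def Q_1)
  moreover have "A 0"
    by (simp add: A_def Q_iff x_def monomial_def ideal_simps(1)[OF P] exI[of _ f] exI[of _ g] exI[of _ h])
  ultimately obtain a where a: "A (Suc a)" "\<not> A (Suc (Suc a))"
    by (metis One_nat_def not0_implies_Suc nat_induct)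
  obtain f1 g1 h1 where
    f1: "f - f1 * x (Suc a) \<in> P" and g1: "g - g1 * x (Suc a) \<in> P" and h1: "h - h1 * x (Suc a) \<in> P"
    using a(1) unfolding A_def Q_iff by blast
  have x_Suc: "x (Suc b) = x 1 * x b" for b
    by (simp add: x_def monomial_mult single_add[symmetric])
  have up: "p \<in> Q (Suc (Suc a))" if "p - p1 * x (Suc a) \<in> P" "p1 \<in> irrelevant_ideal" for p p1
  proof -
    from that(2) obtain r where r: "p1 - r * x 1 \<in> P" unfolding Q_1 Q_iff by blast
    have "(p - p1 * x (Suc a)) + (p1 - r * x 1) * x (Suc a) \<in> P"
      using that(1) r by (intro ideal_simps(2)[OF P] ideal_mult_right[OF P])
    also have "(p - p1 * x (Suc a)) + (p1 - r * x 1) * x (Suc a) = p - r * x (Suc (Suc a))"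
      unfolding x_Suc[of "Suc a"] by (simp add: algebra_simps)
    finally show ?thesis unfolding Q_iff by blast
  qed
  obtain t where t: "f * t - f1 * s \<in> I" "g * t - g1 * s \<in> I" "h * t - h1 * s \<in> I"
  proof -
    have "\<exists>t. f * t - f1 * s \<in> I \<and> g * t - g1 * s \<in> I \<and> h * t - h1 * s \<in> I"
      by (rule regular_triple_lift[OF I])
         (fact f_cancel reg'(2) reg'(3) coprime Ps[OF f1] Ps[OF g1] Ps[OF h1])+
    then show ?thesis using that by blast
  qed
  have t_socle: "var v * t \<in> I" if "v \<noteq> z" for v
  proof (rule colon)
    have *: "p * (var v * t) \<in> I" if "p * t - p1 * s \<in> I" for p p1
    proof -
      have "var v * (p * t - p1 * s) + p1 * (var v * s) \<in> I"
        by (rule ideal_simps(2)[OF I ideal_simps(5)[OF I that]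
              ideal_simps(5)[OF I s_socle[OF \<open>v \<noteq> z\<close>]]])
      then show ?thesis by (simp add: algebra_simps)
    qed
    show "f * (var v * t) \<in> I" "g * (var v * t) \<in> I" using * t by blast+
  qed
  have Pt: "p * t \<in> I" if "p \<in> P" for p
    using P_mult[OF that] t_socle by blast
  \<comment> \<open>If one quotient, say \<open>p\<^sub>1\<close>, has constant term \<open>c \<noteq> 0\<close>, write \<open>p\<^sub>1 = c + r z\<close> modulo \<open>P\<close>.
    Then \<open>p\<^sub>1 s = p t = p\<^sub>1 z\<^sup>a\<^sup>+\<^sup>1 t\<close> modulo \<open>I\<close> exhibits \<open>c s\<close> as \<open>- z t'\<close> modulo \<open>I\<close>.\<close>
  have contra: False
    if p: "p - p1 * x (Suc a) \<in> P" "p * t - p1 * s \<in> I" "p1 \<notin> irrelevant_ideal" for p p1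
  proof -
    define c where "c = lookup p1 0"
    have c: "c \<noteq> 0" using p(3) by (simp add: mem_irrelevant_ideal_iff c_def)
    define C where "C = Poly_Mapping.single (0 :: 'v \<Rightarrow>\<^sub>0 nat) c"
    have "p1 - C \<in> irrelevant_ideal"
      by (simp add: mem_irrelevant_ideal_iff lookup_minus C_def c_def)
    then obtain r where r: "p1 - C - r * x 1 \<in> P" unfolding Q_1 Q_iff by blast
    define t' where "t' = r * s - p1 * x a * t"
    have "(p - p1 * x (Suc a)) * t - (p * t - p1 * s) - (p1 - C - r * x 1) * s \<in> I"
      by (rule ideal_simps(3)[OF I ideal_simps(3)[OF I Pt[OF p(1)] p(2)] Ps[OF r]])
    also have "(p - p1 * x (Suc a)) * t - (p * t - p1 * s) - (p1 - C - r * x 1) * s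
        = C * s + x 1 * t'"
      unfolding x_Suc t'_def by (simp add: algebra_simps)
    finally have "lookup (C * s + x 1 * t') (unit_exponent z + \<rho>) = 0"
      using notin unfolding I_def by (rule lookup_eq_0_of_mem_monomial_ideal)
    moreover have "lookup (C * s) (unit_exponent z + \<rho>) = c"
      by (simp add: C_def s_def monomial_def mult_single)
    moreover have "lookup (x 1 * t') (unit_exponent z + \<rho>) = lookup t' \<rho>"
      unfolding x_def by (rule lookup_monomial_mult)
    \<comment> \<open>\<open>t'\<close> is multiplied into \<open>I\<close> by \<open>y\<close>, whereas \<open>y \<rho>\<close> is not a monomial of \<open>I\<close>.\<close>
    moreover have "lookup t' \<rho> = 0"
    proof -
      have "r * (var y * s) - p1 * x a * (var y * t) \<in> I"
        by (rule ideal_simps(3)[OF I ideal_simps(5)[OF I s_socle[OF y(1)]]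
              ideal_simps(5)[OF I t_socle[OF y(1)]]])
      also have "r * (var y * s) - p1 * x a * (var y * t) = monomial (unit_exponent y) * t'"
        by (simp add: t'_def var_eq_monomial algebra_simps)
      finally have "lookup (monomial (unit_exponent y) * t') (unit_exponent y + \<rho>) = 0"
        using y(2) unfolding I_def by (rule lookup_eq_0_of_mem_monomial_ideal)
      then show ?thesis by (simp only: lookup_monomial_mult)
    qed
    ultimately show False using c by (simp add: lookup_add)
  qed
  \<comment> \<open>So all three quotients are divisible by \<open>z\<close> modulo \<open>P\<close>, against the maximality of the power.\<close>
  have "f1 \<in> irrelevant_ideal" "g1 \<in> irrelevant_ideal" "h1 \<in> irrelevant_ideal"
    using contra[OF f1 t(1)] contra[OF g1 t(2)] contra[OF h1 t(3)] by blast+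
  then have "A (Suc (Suc a))" using up f1 g1 h1 unfolding A_def by blast
  then show False using a(2) by blast
qed

text \<open>If \<open>y m = z i\<close> then \<open>m = z j\<close> and \<open>i = y j\<close>, so regularity of \<open>y\<close> modulo \<open>z\<close> asks exactly that
  \<open>j\<close> lies in the ideal whenever \<open>z j\<close> and \<open>y j\<close> do. For a monomial ideal this can be tested on
  monomials.\<close>

lemma regular_sequence_two_variables:
  fixes G :: "('v::finite \<Rightarrow>\<^sub>0 nat) set"
  assumes "G \<noteq> {}" "y \<noteq> z"
    and colon: "\<And>\<tau>. unit_exponent z + \<tau> \<in> multiples G \<Longrightarrow> unit_exponent y + \<tau> \<in> multiples G
      \<Longrightarrow> \<tau> \<in> multiples G"
  shows "regular_sequence (*) (monomial_ideal G :: ('v, 'k::field) mvpoly set) [var z, var y]"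
proof (rule regular_sequence_of_length_twoI[OF ideal_monomial_ideal])
  fix m i :: "('v, 'k) mvpoly"
  show "m = 0" if "var z * m = 0"
    using that monomial_cancel[of "unit_exponent z" m 0] by (simp add: var_eq_monomial)
  assume m: "m \<in> monomial_ideal G" and i: "i \<in> monomial_ideal G" and eq: "var y * m = var z * i"
  have "m \<in> monomial_ideal {unit_exponent z}"
    unfolding mem_monomial_ideal_iff
  proof
    fix \<tau> assume "\<tau> \<in> keys m"
    then have "unit_exponent y + \<tau> \<in> (+) (unit_exponent z) ` keys i"
      using keys_monomial_mult eq unfolding var_eq_monomial by (metis imageI)
    then obtain \<kappa> where "unit_exponent y + \<tau> = unit_exponent z + \<kappa>" by blast
    then have "lookup (unit_exponent y + \<tau>) z = lookup (unit_exponent z + \<kappa>) z" by simp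
    then have "1 \<le> lookup \<tau> z" using assms(2) by (simp add: lookup_add lookup_single)
    then show "\<tau> \<in> multiples {unit_exponent z}"
      using mem_multiples_unit_exponents_iff[of \<tau> "{z}"] by simp
  qed
  then obtain j where "m = j * monomial (unit_exponent z)"
    by (auto simp: monomial_ideal_def module.span_singleton[OF module_times])
  then have j: "m = var z * j" by (simp add: var_eq_monomial mult.commute)
  have "monomial (unit_exponent z) * i = monomial (unit_exponent z) * (var y * j)"
    using eq unfolding j by (simp add: var_eq_monomial algebra_simps)
  then have ij: "i = var y * j" by (rule monomial_cancel)
  have "j \<in> monomial_ideal G"
    using m i unfolding j ij var_eq_monomial mem_monomial_ideal_iff keys_monomial_mult
    using colon by blast
  then show "\<exists>j\<in>monomial_ideal G. m = var z * j" using j by blast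
next
  have "submodule_mult (*) {var z, var y} (monomial_ideal G :: ('v, 'k) mvpoly set)
      \<subseteq> submodule_mult (*) irrelevant_ideal (monomial_ideal G)"
    by (intro submodule_mult_mono)
       (auto simp: irrelevant_ideal_def intro: module.span_base[OF module_times])
  then show "submodule_mult (*) {var z, var y} (monomial_ideal G :: ('v, 'k) mvpoly set)
      \<noteq> monomial_ideal G"
    using irrelevant_ideal_mult_monomial_ideal[OF assms(1), where 'k = 'k]
      submodule_mult_subset[OF ideal_monomial_ideal, of irrelevant_ideal G] by blast
qed

theorem depth_monomial_ideal_eq_2:
  fixes G :: "('v::finite \<Rightarrow>\<^sub>0 nat) set"
  assumes "y \<noteq> z"
    and notin: "unit_exponent z + \<rho> \<notin> multiples G" "unit_exponent y + \<rho> \<notin> multiples G"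
    and socle: "\<And>v. v \<noteq> z \<Longrightarrow> unit_exponent v + (unit_exponent z + \<rho>) \<in> multiples G"
    and colon: "\<And>\<tau>. unit_exponent z + \<tau> \<in> multiples G \<Longrightarrow> unit_exponent y + \<tau> \<in> multiples G
      \<Longrightarrow> \<tau> \<in> multiples G"
  shows "depth (*) irrelevant_ideal (monomial_ideal G :: ('v, 'k::field) mvpoly set) = 2"
proof -
  let ?I = "monomial_ideal G :: ('v, 'k) mvpoly set"
  let ?L = "{enat (length fs) | fs. set fs \<subseteq> irrelevant_ideal \<and> regular_sequence (*) ?I fs}"
  have G: "G \<noteq> {}" using socle[OF assms(1)] by (auto simp: multiples_def)
  have "length fs \<le> 2" if fs: "set fs \<subseteq> irrelevant_ideal" "regular_sequence (*) ?I fs" for fs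
  proof (rule ccontr)
    assume "\<not> length fs \<le> 2"
    then obtain f g h fs' where "fs = f # g # h # fs'"
      by (metis (no_types) One_nat_def Suc_1 le_Suc_eq length_Cons less_Suc_eq_le list.exhaust
          list.size(3) not_less_eq_eq zero_le)
    then show False
      using no_regular_sequence_of_length_three[of G f g h fs' z \<rho> y] fs assms by auto
  qed
  then have "Sup ?L \<le> 2"
    by (intro Sup_least) (auto simp: numeral_eq_enat)
  moreover have "2 \<le> Sup ?L"
  proof (intro Sup_upper CollectI exI conjI)
    show "2 = enat (length [var z, var y :: ('v, 'k) mvpoly])" by (simp add: numeral_eq_enat)
    show "set [var z, var y :: ('v, 'k) mvpoly] \<subseteq> irrelevant_ideal"
      by (auto simp: irrelevant_ideal_def intro: module.span_base[OF module_times])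
    show "regular_sequence (*) ?I [var z, var y]"
      using regular_sequence_two_variables[OF G assms(1) colon] by blast
  qed
  ultimately show ?thesis
    unfolding depth_def using irrelevant_ideal_mult_monomial_ideal[OF G, where 'k = 'k] by simp
qed

section \<open>Edge ideals of stars\<close>

definition edge_exponents :: "'v pair_pre_digraph \<Rightarrow> ('v \<Rightarrow> nat) \<Rightarrow> ('v \<Rightarrow>\<^sub>0 nat) set" where
  "edge_exponents D w = (\<lambda>(u, v). unit_exponent u + Poly_Mapping.single v (w v)) ` parcs D"

lemma monomial_power: "monomial (unit_exponent v) ^ k = monomial (Poly_Mapping.single v k)"
  by (induction k) (simp_all add: monomial_def mult_single single_add[symmetric])

lemma edge_ideal_eq_monomial_ideal: "edge_ideal D w = monomial_ideal (edge_exponents D w)"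
  unfolding edge_ideal_def monomial_ideal_def edge_exponents_def
    var_eq_monomial monomial_power monomial_mult
  by (rule arg_cong[where f = ideal_generated]) (force simp: image_image)

text \<open>A generator \<open>x\<^sub>u x\<^sub>v\<^sup>w\<close> divides a monomial iff its two coprime factors do; the absence of loops
  is what makes them coprime.\<close>

lemma mem_multiples_edge_exponents_iff:
  assumes "\<And>u v. (u, v) \<in> parcs D \<Longrightarrow> u \<noteq> v"
  shows "\<tau> \<in> multiples (edge_exponents D w) \<longleftrightarrow>
    (\<exists>(u, v)\<in>parcs D. 1 \<le> lookup \<tau> u \<and> w v \<le> lookup \<tau> v)"
proof -
  have le: "(\<forall>a. lookup (unit_exponent u + Poly_Mapping.single v (w v)) a \<le> lookup \<tau> a) \<longleftrightarrow>
      1 \<le> lookup \<tau> u \<and> w v \<le> lookup \<tau> v" if "(u, v) \<in> parcs D" for u v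
  proof -
    have "lookup (unit_exponent u + Poly_Mapping.single v (w v)) a =
        (if a = u then 1 else if a = v then w v else 0)" for a
      using assms[OF that] by (simp add: lookup_add lookup_single when_def)
    then show ?thesis using assms[OF that] by (metis zero_le)
  qed
  show ?thesis
    unfolding multiples_def edge_exponents_def bex_simps mem_Collect_eq
  proof (rule bex_cong[OF refl])
    fix e assume "e \<in> parcs D"
    moreover obtain u v where "e = (u, v)" by fastforce
    ultimately show "(\<forall>a. lookup (case e of (u, v) \<Rightarrow> unit_exponent u + Poly_Mapping.single v (w v)) a
        \<le> lookup \<tau> a) \<longleftrightarrow> (case e of (u, v) \<Rightarrow> 1 \<le> lookup \<tau> u \<and> w v \<le> lookup \<tau> v)"
      by (simp only: prod.case le)
  qed
qed

lemma exponent_exists: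
  fixes \<phi> :: "'v::finite \<Rightarrow> nat"
  shows "\<exists>\<tau>. lookup \<tau> = \<phi>"
  by (metis finite_class.finite lookup_Abs_poly_mapping)

text \<open>Here \<open>I = x\<^sub>c \<cdot> (x\<^sub>v\<^sup>w\<^sup>(\<^sup>v\<^sup>) | v \<noteq> c)\<close>. The variable \<open>z\<close> is the centre, and
  \<open>s = x\<^sub>c \<cdot> \<Prod> x\<^sub>v\<^sup>w\<^sup>(\<^sup>v\<^sup>)\<^sup>-\<^sup>1\<close>, where the product over the leaves spans the socle of the quotient by
  the powers \<open>x\<^sub>v\<^sup>w\<^sup>(\<^sup>v\<^sup>)\<close> in the leaves alone. Any leaf can serve as \<open>y\<close>.\<close>

lemma depth_edge_ideal_out_star:
  fixes w :: "'v::finite \<Rightarrow> nat"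
  assumes D: "parcs D = Pair c ` (- {c})" and "y \<noteq> c" and w: "\<And>v. w v \<ge> 1"
  shows "depth (*) irrelevant_ideal (edge_ideal D w :: ('v, 'k::field) mvpoly set) = 2"
proof -
  have mem: "\<tau> \<in> multiples (edge_exponents D w) \<longleftrightarrow>
      1 \<le> lookup \<tau> c \<and> (\<exists>v. v \<noteq> c \<and> w v \<le> lookup \<tau> v)" for \<tau>
    by (subst mem_multiples_edge_exponents_iff) (auto simp: D)
  obtain \<rho> where \<rho>: "lookup \<rho> = (\<lambda>v. if v = c then 0 else w v - 1)"
    using exponent_exists by blast
  have less: "\<not> w v \<le> w v - Suc 0" for v using w[of v] by simp
  show ?thesis
    unfolding edge_ideal_eq_monomial_ideal
  proof (rule depth_monomial_ideal_eq_2[OF \<open>y \<noteq> c\<close>, where \<rho> = \<rho>]; unfold mem)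
    fix \<tau>
    assume "1 \<le> lookup (unit_exponent c + \<tau>) c \<and> (\<exists>v. v \<noteq> c \<and> w v \<le> lookup (unit_exponent c + \<tau>) v)"
      and "1 \<le> lookup (unit_exponent y + \<tau>) c \<and> (\<exists>v. v \<noteq> c \<and> w v \<le> lookup (unit_exponent y + \<tau>) v)"
    then show "1 \<le> lookup \<tau> c \<and> (\<exists>v. v \<noteq> c \<and> w v \<le> lookup \<tau> v)"
      using \<open>y \<noteq> c\<close> by (auto simp: lookup_add lookup_single)
  next
    fix v assume "v \<noteq> c"
    then show "1 \<le> lookup (unit_exponent v + (unit_exponent c + \<rho>)) c \<and>
        (\<exists>u. u \<noteq> c \<and> w u \<le> lookup (unit_exponent v + (unit_exponent c + \<rho>)) u)"
      by (auto simp: lookup_add lookup_single \<rho> intro!: exI[of _ v])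
  qed (use \<open>y \<noteq> c\<close> less in \<open>auto simp: lookup_add lookup_single \<rho>\<close>)
qed

text \<open>Here \<open>I = x\<^sub>c\<^sup>w \<cdot> (x\<^sub>v | v \<noteq> c)\<close> with \<open>w = w c\<close>. Again \<open>z\<close> is the centre, and now
  \<open>s = x\<^sub>c\<^sup>w\<close>.\<close>

lemma depth_edge_ideal_in_star:
  fixes w :: "'v::finite \<Rightarrow> nat"
  assumes D: "parcs D = (\<lambda>v. (v, c)) ` (- {c})" and "y \<noteq> c" and w: "w c \<ge> 1"
  shows "depth (*) irrelevant_ideal (edge_ideal D w :: ('v, 'k::field) mvpoly set) = 2"
proof -
  have mem: "\<tau> \<in> multiples (edge_exponents D w) \<longleftrightarrow>
      w c \<le> lookup \<tau> c \<and> (\<exists>v. v \<noteq> c \<and> 1 \<le> lookup \<tau> v)" for \<tau>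
    by (subst mem_multiples_edge_exponents_iff) (auto simp: D)
  obtain \<rho> where \<rho>: "lookup \<rho> = (\<lambda>v. if v = c then w c - 1 else 0)"
    using exponent_exists by blast
  show ?thesis
    unfolding edge_ideal_eq_monomial_ideal
  proof (rule depth_monomial_ideal_eq_2[OF \<open>y \<noteq> c\<close>, where \<rho> = \<rho>]; unfold mem)
    fix \<tau>
    assume "w c \<le> lookup (unit_exponent c + \<tau>) c \<and> (\<exists>v. v \<noteq> c \<and> 1 \<le> lookup (unit_exponent c + \<tau>) v)"
      and "w c \<le> lookup (unit_exponent y + \<tau>) c \<and> (\<exists>v. v \<noteq> c \<and> 1 \<le> lookup (unit_exponent y + \<tau>) v)"
    then show "w c \<le> lookup \<tau> c \<and> (\<exists>v. v \<noteq> c \<and> 1 \<le> lookup \<tau> v)"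
      using \<open>y \<noteq> c\<close> by (auto simp: lookup_add lookup_single)
  next
    fix v assume "v \<noteq> c"
    then show "w c \<le> lookup (unit_exponent v + (unit_exponent c + \<rho>)) c \<and>
        (\<exists>u. u \<noteq> c \<and> 1 \<le> lookup (unit_exponent v + (unit_exponent c + \<rho>)) u)"
      using w by (auto simp: lookup_add lookup_single \<rho> intro!: exI[of _ v])
  qed (use \<open>y \<noteq> c\<close> w in \<open>auto simp: lookup_add lookup_single when_def \<rho>\<close>)
qed

text \<open>Here \<open>I = x\<^sub>c \<cdot> (x\<^sub>r x\<^sub>c\<^sup>w\<^sup>-\<^sup>1, x\<^sub>v\<^sup>w\<^sup>(\<^sup>v\<^sup>) | v \<noteq> r, c)\<close> with \<open>w = w c\<close>. The variable \<open>z\<close> is the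
  centre \<open>c\<close>, and \<open>s = x\<^sub>c\<^sup>w \<cdot> \<Prod> x\<^sub>v\<^sup>w\<^sup>(\<^sup>v\<^sup>)\<^sup>-\<^sup>1\<close>, the product being over \<open>v \<noteq> r, c\<close>. The power of
  \<open>x\<^sub>c\<close> in \<open>s\<close> is the least for which \<open>x\<^sub>r s\<close> lies in \<open>I\<close>, so \<open>y\<close> is taken to be \<open>r\<close>.\<close>

lemma depth_edge_ideal_one_in_star:
  fixes w :: "'v::finite \<Rightarrow> nat"
  assumes D: "parcs D = insert (r, c) (Pair c ` (- {r, c}))" and "r \<noteq> c" and w: "\<And>v. w v \<ge> 1"
  shows "depth (*) irrelevant_ideal (edge_ideal D w :: ('v, 'k::field) mvpoly set) = 2"
proof -
  have mem: "\<tau> \<in> multiples (edge_exponents D w) \<longleftrightarrow>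
      1 \<le> lookup \<tau> r \<and> w c \<le> lookup \<tau> c \<or>
      1 \<le> lookup \<tau> c \<and> (\<exists>v. v \<noteq> r \<and> v \<noteq> c \<and> w v \<le> lookup \<tau> v)" for \<tau>
    by (subst mem_multiples_edge_exponents_iff) (use \<open>r \<noteq> c\<close> in \<open>auto simp: D\<close>)
  obtain \<rho> where \<rho>: "lookup \<rho> = (\<lambda>v. if v = r then 0 else w v - 1)"
    using exponent_exists by blast
  have less: "\<not> w v \<le> w v - Suc 0" for v using w[of v] by simp
  show ?thesis
    unfolding edge_ideal_eq_monomial_ideal
  proof (rule depth_monomial_ideal_eq_2[OF \<open>r \<noteq> c\<close>, where \<rho> = \<rho>]; unfold mem)
    fix \<tau>
    let ?E = "\<lambda>\<tau>. 1 \<le> lookup \<tau> r \<and> w c \<le> lookup \<tau> c \<or>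
      1 \<le> lookup \<tau> c \<and> (\<exists>v. v \<noteq> r \<and> v \<noteq> c \<and> w v \<le> lookup \<tau> v)"
    assume c: "?E (unit_exponent c + \<tau>)" and r: "?E (unit_exponent r + \<tau>)"
    from r consider "w c \<le> lookup \<tau> c"
      | v where "1 \<le> lookup \<tau> c" "v \<noteq> r" "v \<noteq> c" "w v \<le> lookup \<tau> v"
      using \<open>r \<noteq> c\<close> by (auto simp: lookup_add lookup_single)
    then show "?E \<tau>"
    proof cases
      case 1
      then have "1 \<le> lookup \<tau> c" using w[of c] by simp
      then show ?thesis
        using c 1 \<open>r \<noteq> c\<close> by (auto simp: lookup_add lookup_single)
    qed blast
  next
    fix v assume "v \<noteq> c"
    show "1 \<le> lookup (unit_exponent v + (unit_exponent c + \<rho>)) r \<and>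
          w c \<le> lookup (unit_exponent v + (unit_exponent c + \<rho>)) c \<or>
        1 \<le> lookup (unit_exponent v + (unit_exponent c + \<rho>)) c \<and>
        (\<exists>u. u \<noteq> r \<and> u \<noteq> c \<and> w u \<le> lookup (unit_exponent v + (unit_exponent c + \<rho>)) u)"
      using \<open>v \<noteq> c\<close> \<open>r \<noteq> c\<close>
      by (cases "v = r") (auto simp: lookup_add lookup_single \<rho> intro!: exI[of _ v])
  qed (use \<open>r \<noteq> c\<close> less in \<open>auto simp: lookup_add lookup_single when_def \<rho>\<close>)
qed

theorem corollary3p2:
  fixes n :: nat
    and x :: "nat \<Rightarrow> 'v::finite"
    and D :: "'v pair_pre_digraph"
    and w :: "'v \<Rightarrow> nat"
  assumes "n \<ge> 2"
    and "vertex_weighted_oriented_star D w"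
    and "pverts D = UNIV"
    and "bij_betw x {1..n} (pverts D)"
    and "\<forall>v\<in>pverts D. w v \<ge> 2"
    and "parcs D = {(x 1, x j) | j. j \<in> {2..n}} \<or>
         parcs D = {(x j, x 1) | j. j \<in> {2..n}} \<or>
         parcs D = insert (x 1, x 2) {(x 2, x j) | j. j \<in> {3..n}}"
  shows "depth (*) irrelevant_ideal (edge_ideal D w :: ('v, 'k::field) mvpoly set) = 2"
proof -
  have bij: "bij_betw x {1..n} UNIV" using assms(3,4) by simp
  have inj: "x i = x j \<longleftrightarrow> i = j" if "i \<in> {1..n}" "j \<in> {1..n}" for i j
    using bij_betw_imp_inj_on[OF bij] that by (simp add: inj_on_eq_iff)
  have img: "\<exists>j\<in>{1..n}. v = x j" for v
    using bij_betw_imp_surj_on[OF bij] by blast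
  have w: "w v \<ge> 1" for v 
    using order_trans[of 1 2 "w v"] assms(3,5) by auto
  have neq: "x 2 \<noteq> x 1" using inj[of 2 1] assms(1) by simp
  have leaves: "- {x 1} = x ` {2..n}"
  proof (intro equalityI subsetI)
    fix v assume "v \<in> - {x 1}"
    moreover obtain j where "j \<in> {1..n}" "v = x j" using img by blast
    ultimately show "v \<in> x ` {2..n}" by (cases "j = 1") auto
  qed (use inj[of _ 1] in auto)
  have leaves': "- {x 1, x 2} = x ` {3..n}"
  proof (intro equalityI subsetI)
    fix v assume "v \<in> - {x 1, x 2}"
    moreover obtain j where "j \<in> {1..n}" "v = x j" using img by blast
    ultimately show "v \<in> x ` {3..n}" by (cases "j = 1"; cases "j = 2") auto
  qed (use inj[of _ 1] inj[of _ 2] in auto)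
  from assms(6) consider "parcs D = Pair (x 1) ` (- {x 1})"
    | "parcs D = (\<lambda>v. (v, x 1)) ` (- {x 1})"
    | "parcs D = insert (x 1, x 2) (Pair (x 2) ` (- {x 1, x 2}))"
    unfolding leaves leaves' image_image Setcompr_eq_image by blast
  then show ?thesis
  proof cases
    case 1
    then show ?thesis using depth_edge_ideal_out_star neq w by metis
  next
    case 2
    then show ?thesis using depth_edge_ideal_in_star neq w by metis
  next
    case 3
    then show ?thesis using depth_edge_ideal_one_in_star neq w by metis
  qed
qed

end
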